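(* Let $\ell>2$ be an odd prime, let $\gamma$ be a primitive root modulo $\ell$, let $N\in\mathbb F_\ell^*$, and put $A=4\gamma N$, $B=4\gamma^2N$. Define $$E(A,B):=r_B\,\chi(B-A)+r_A\,\chi(A-B).$$ Then $E(A,B)\in\{-2,2\}$ and $$|U_{\gamma,\gamma^2}(N;\ell)|=\frac{3\ell-K(A,B)-E(A,B)}{4}.$$
   Context: $\chi$ denotes the Legendre symbol modulo $\ell$ on $\mathbb F_\ell$, with $\chi(0)=0$. A primitive root modulo $\ell$ is a generator of the cyclic group $\mathbb F_\ell^*$. For $T\in\mathbb F_\ell^*$, $r_T=1+\chi(T)$. $K(A,B)=\sum_{z\in\mathbb F_\ell}\chi\bigl((z^2-A)(z^2-B)\bigr)$. For $a,b,N\in\mathbb F_\ell^*$, $H_a(N;\ell)=\{ax+Nx^{-1}:x\in\mathbb F_\ell^*\}\subseteq\mathbb F_\ell$ and $U_{a,b}(N;\ell)=H_a(N;\ell)\cup H_b(N;\ell)$. *)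

theory Defs
  imports "Berlekamp_Zassenhaus.Finite_Field" "HOL-Number_Theory.Number_Theory"
begin

(* The prime field F_l is the type 'p mod_ring with 'p :: prime_card and l = CARD('p). *)

definition chi :: "'p::prime_card mod_ring \<Rightarrow> int" where
  "chi x = Legendre (to_int_mod_ring x) (int CARD('p))"

definition primitive_root :: "'p::prime_card mod_ring \<Rightarrow> bool" where
  "primitive_root g \<longleftrightarrow> {g powi k | k :: int. True} = {x. x \<noteq> 0}"

definition r :: "'p::prime_card mod_ring \<Rightarrow> int" where
  "r T = 1 + chi T"

definition K :: "'p::prime_card mod_ring \<Rightarrow> 'p mod_ring \<Rightarrow> int" where
  "K A B = (\<Sum>z\<in>UNIV. chi ((z^2 - A) * (z^2 - B)))"

definition E :: "'p::prime_card mod_ring \<Rightarrow> 'p mod_ring \<Rightarrow> int" where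
  "E A B = r B * chi (B - A) + r A * chi (A - B)"

definition H :: "'p::prime_card mod_ring \<Rightarrow> 'p mod_ring \<Rightarrow> 'p mod_ring set" where
  "H a N = {a * x + N * inverse x | x. x \<noteq> 0}"

definition U :: "'p::prime_card mod_ring \<Rightarrow> 'p mod_ring \<Rightarrow> 'p mod_ring \<Rightarrow> 'p mod_ring set" where
  "U a b N = H a N \<union> H b N"

end

theory Submission
  imports Defs
begin

text \<open>
  By the quadratic formula, \<open>y\<close> lies in \<open>H a N\<close> exactly when the discriminant
  \<open>y\<^sup>2 - 4 a N\<close> is a square, zero included (\<open>mem_H_iff\<close>). With \<open>A = 4 a N\<close> and
  \<open>B = 4 b N\<close>, the complement of \<open>U a b N\<close> therefore consists of the \<open>y\<close> for which
  \<open>f = chi (y\<^sup>2 - A)\<close> and \<open>g = chi (y\<^sup>2 - B)\<close> both equal \<open>-1\<close>, and wherever \<open>f\<close> and \<open>g\<close>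
  are both nonzero, the indicator of that complement is \<open>(1 - f) (1 - g) / 4\<close>. When this
  product is expanded and summed over all \<open>y\<close>, the sum of \<open>f g\<close> is \<open>K A B\<close>, because \<open>chi\<close>
  is multiplicative (a consequence of Euler's criterion), and the sums of \<open>f\<close> and of \<open>g\<close>
  are \<open>-1\<close>, because the hyperbola \<open>y\<^sup>2 - z\<^sup>2 = A\<close> is parametrised by the nonzero elements of
  the field (\<open>sum_chi_square_minus\<close>). The product is wrong only at the \<open>r A\<close> zeros of \<open>f\<close>,
  where \<open>g = chi (A - B)\<close>, and at the \<open>r B\<close> zeros of \<open>g\<close>, where \<open>f = chi (B - A)\<close>; correcting
  it there produces \<open>r A + r B - E A B\<close>. This gives \<open>card_U\<close>, valid for arbitrary distinct
  nonzero \<open>a\<close> and \<open>b\<close>.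

  For \<open>a = \<gamma>\<close> and \<open>b = \<gamma>\<^sup>2\<close> with \<open>\<gamma>\<close> a primitive root, \<open>\<gamma>\<close> is not a square, so
  exactly one of \<open>A\<close> and \<open>B = \<gamma> A\<close> is a square: one of \<open>r A\<close>, \<open>r B\<close> is \<open>2\<close> and the other
  \<open>0\<close>. Hence \<open>r A + r B = 2\<close>, and \<open>E A B\<close> reduces to a single term \<open>2 chi (\<plusminus>(B - A))\<close>.
\<close>

section \<open>The Legendre symbol on the prime field\<close>

lemma two_neq_zero:
  assumes "CARD('p::prime_card) > 2"
  shows "(2 :: 'p mod_ring) \<noteq> 0"
proof
  assume "(2 :: 'p mod_ring) = 0"
  then have "of_nat 2 = (0 :: 'p mod_ring)" by simp
  then have "CARD('p) dvd 2" by (rule of_nat_0_mod_ring_dvd)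
  then show False using assms by (auto dest: dvd_imp_le)
qed

lemma four_neq_zero:
  assumes "CARD('p::prime_card) > 2"
  shows "(4 :: 'p mod_ring) \<noteq> 0"
  using no_zero_divisors[OF two_neq_zero[OF assms] two_neq_zero[OF assms]] by simp

lemma half_sum_plus_half_diff:
  fixes u v :: "'p::prime_card mod_ring"
  assumes "CARD('p) > 2"
  shows "(u + v) / 2 + (u - v) / 2 = u"
proof -
  have "(u + v) / 2 + (u - v) / 2 = (2 * u) / 2" by (simp flip: add_divide_distrib)
  then show ?thesis using two_neq_zero[OF assms] by simp
qed

lemma half_sum_minus_half_diff:
  fixes u v :: "'p::prime_card mod_ring"
  assumes "CARD('p) > 2"
  shows "(u + v) / 2 - (u - v) / 2 = v"
proof -
  have "(u + v) / 2 - (u - v) / 2 = (2 * v) / 2" by (simp flip: diff_divide_distrib)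
  then show ?thesis using two_neq_zero[OF assms] by simp
qed

lemma of_int_eq_iff_cong_CARD:
  "(of_int a :: 'p::prime_card mod_ring) = of_int b \<longleftrightarrow> [a = b] (mod int CARD('p))"
  using of_int_eq_iff_cong_CHAR[where 'a="'p mod_ring"] by simp

lemma of_int_to_int_mod_ring [simp]:
  "of_int (to_int_mod_ring x) = (x :: 'p::prime_card mod_ring)"
  by (simp add: of_int_of_int_mod_ring)

lemma chi_eq:
  fixes x :: "'p::prime_card mod_ring"
  shows "chi x = (if x = 0 then 0 else if \<exists>s. x = s^2 then 1 else -1)"
proof -
  have 0: "[to_int_mod_ring x = 0] (mod int CARD('p)) \<longleftrightarrow> x = 0"
    using of_int_eq_iff_cong_CARD[of "to_int_mod_ring x" 0, where 'p='p] by simp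
  have "[i^2 = to_int_mod_ring x] (mod int CARD('p)) \<longleftrightarrow> (of_int i)^2 = x" for i
    using of_int_eq_iff_cong_CARD[of "i^2" "to_int_mod_ring x", where 'p='p] by simp
  then have "QuadRes (int CARD('p)) (to_int_mod_ring x) \<longleftrightarrow> (\<exists>s. x = s^2)"
    unfolding QuadRes_def by (metis of_int_to_int_mod_ring)
  with 0 show ?thesis by (simp add: chi_def Legendre_def)
qed

lemma chi_zero [simp]: "chi 0 = 0"
  by (simp add: chi_eq)

lemma chi_cases: "chi x \<in> {-1, 0, 1}"
  by (simp add: chi_eq)

lemma chi_square: "s \<noteq> 0 \<Longrightarrow> chi (s^2) = 1"
  by (auto simp: chi_eq)

lemma chi_neq_minus_one_iff: "chi x \<noteq> -1 \<longleftrightarrow> (\<exists>s. x = s^2)"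
  by (auto simp: chi_eq intro: exI[of _ 0])

lemma of_int_chi:
  fixes x :: "'p::prime_card mod_ring"
  assumes "CARD('p) > 2"
  shows "of_int (chi x) = x ^ ((CARD('p) - 1) div 2)"
  using euler_criterion[OF prime_card assms, of "to_int_mod_ring x"]
  unfolding chi_def of_int_eq_iff_cong_CARD[symmetric] by simp

text \<open>
  Euler's criterion expresses \<open>chi\<close> as a power map into the field; nothing is lost on the
  way back to the integers because \<open>-1\<close>, \<open>0\<close> and \<open>1\<close> remain distinct in odd characteristic.
\<close>

lemma chi_mult:
  fixes x y :: "'p::prime_card mod_ring"
  assumes "CARD('p) > 2"
  shows "chi (x * y) = chi x * chi y"
proof -
  have eq: "of_int (chi (x * y)) = (of_int (chi x * chi y) :: 'p mod_ring)"
    by (simp add: of_int_chi[OF assms] power_mult_distrib)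
  have neq: "(1 :: 'p mod_ring) \<noteq> -1"
    using two_neq_zero[OF assms] by (simp add: eq_neg_iff_add_eq_0)
  show ?thesis
    using eq neq chi_cases[of x] chi_cases[of y] chi_cases[of "x * y"] by auto
qed

text \<open>
  If \<open>g\<close> were a square, squaring would be surjective, hence injective, on a finite field in
  which \<open>1\<close> and \<open>-1\<close> differ but have the same square.
\<close>

lemma chi_primitive_root:
  fixes g :: "'p::prime_card mod_ring"
  assumes card: "CARD('p) > 2" and g: "primitive_root g"
  shows "chi g = -1"
proof (rule ccontr)
  assume "chi g \<noteq> -1"
  then obtain s where s: "g = s^2" by (auto simp: chi_neq_minus_one_iff)
  have "\<exists>t. z = t^2" for z :: "'p mod_ring"
  proof (cases "z = 0")
    case False
    then obtain k :: int where "z = g powi k"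
      using g unfolding primitive_root_def by blast
    then have "z = (s powi k)^2"
      by (simp add: s power2_eq_square power_int_mult_distrib)
    then show ?thesis by blast
  qed (auto intro: exI[of _ 0])
  then have "surj (\<lambda>t :: 'p mod_ring. t^2)" by (auto simp: surj_def)
  then have "inj (\<lambda>t :: 'p mod_ring. t^2)" by (simp add: finite_UNIV_surj_inj)
  then have "(1 :: 'p mod_ring) = -1" by (rule injD) simp
  then show False
    using two_neq_zero[OF card] by (simp add: eq_neg_iff_add_eq_0)
qed

section \<open>Counting square roots\<close>

lemma card_square_roots:
  fixes T :: "'p::prime_card mod_ring"
  assumes "CARD('p) > 2"
  shows "int (card {z. z^2 = T}) = r T"
proof (cases "\<exists>s. T = s^2")
  case True
  then obtain s where s: "T = s^2" by blast
  have roots: "{z. z^2 = T} = {s, -s}" by (auto simp: s power2_eq_iff)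
  have "s = -s \<longleftrightarrow> s = 0"
    using two_neq_zero[OF assms] by (simp add: eq_neg_iff_add_eq_0 flip: mult_2)
  then show ?thesis
    unfolding roots by (cases "s = 0") (auto simp: r_def s chi_square)
next
  case False
  then have "{z. z^2 = T} = {}" by auto
  moreover have "chi T = -1" using False chi_neq_minus_one_iff by blast
  ultimately show ?thesis by (simp add: r_def)
qed

text \<open>
  The sum of \<open>1 + chi (y\<^sup>2 - A)\<close> counts the points of the hyperbola \<open>y\<^sup>2 - z\<^sup>2 = A\<close>. The
  coordinates \<open>u = y + z\<close> and \<open>v = y - z\<close> turn it into \<open>u v = A\<close>, which has one point for
  each nonzero \<open>u\<close>.
\<close>

lemma sum_chi_square_minus:
  fixes A :: "'p::prime_card mod_ring"
  assumes card: "CARD('p) > 2" and A: "A \<noteq> 0"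
  shows "(\<Sum>y\<in>UNIV. chi (y^2 - A)) = -1"
proof -
  note two = two_neq_zero[OF card]
  define S where "S = (SIGMA y:UNIV. {z. z^2 = y^2 - A})"
  have "bij_betw (\<lambda>(y, z). y + z) S (- {0})"
  proof (rule bij_betw_byWitness[where f' = "\<lambda>u. ((u + A / u) / 2, (u - A / u) / 2)"])
    have "((y + z + A / (y + z)) / 2, (y + z - A / (y + z)) / 2) = (y, z)"
      if "z^2 = y^2 - A" for y z
    proof -
      have "A = (y + z) * (y - z)"
        using that by (simp add: algebra_simps power2_eq_square)
      then have "A / (y + z) = y - z" using A by auto
      then show ?thesis using two by simp
    qed
    then show "\<forall>p\<in>S. (\<lambda>u. ((u + A / u) / 2, (u - A / u) / 2)) ((\<lambda>(y, z). y + z) p) = p"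
      by (auto simp: S_def)
    show "\<forall>u\<in>- {0}. (\<lambda>(y, z). y + z) ((u + A / u) / 2, (u - A / u) / 2) = u"
      by (simp add: half_sum_plus_half_diff[OF card])
    have "y + z \<noteq> 0" if "z^2 = y^2 - A" for y z
    proof
      assume "y + z = 0"
      then have "z = - y" by (simp add: eq_neg_iff_add_eq_0 add.commute)
      with that A show False by simp
    qed
    then show "(\<lambda>(y, z). y + z) ` S \<subseteq> - {0}" by (auto simp: S_def)
    have "((u - A / u) / 2)^2 = ((u + A / u) / 2)^2 - A" if "u \<noteq> 0" for u
    proof -
      have "((u + A / u) / 2)^2 - ((u - A / u) / 2)^2
          = ((u + A / u) / 2 + (u - A / u) / 2) * ((u + A / u) / 2 - (u - A / u) / 2)"
        by (simp add: power2_eq_square algebra_simps)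
      also have "(u + A / u) / 2 + (u - A / u) / 2 = u"
        by (rule half_sum_plus_half_diff[OF card])
      also have "(u + A / u) / 2 - (u - A / u) / 2 = A / u"
        by (rule half_sum_minus_half_diff[OF card])
      finally show ?thesis using that by (simp add: algebra_simps)
    qed
    then show "(\<lambda>u. ((u + A / u) / 2, (u - A / u) / 2)) ` (- {0}) \<subseteq> S"
      by (auto simp: S_def)
  qed
  then have "card S = CARD('p) - 1"
    using bij_betw_same_card by (fastforce simp: Compl_eq_Diff_UNIV card_Diff_singleton)
  then have "int CARD('p) - 1 = int (card S)" using card by simp
  also have "\<dots> = (\<Sum>y\<in>UNIV. int (card {z. z^2 = y^2 - A}))" by (simp add: S_def)
  also have "\<dots> = int CARD('p) + (\<Sum>y\<in>UNIV. chi (y^2 - A))"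
    by (simp add: card_square_roots[OF card] r_def sum.distrib)
  finally show ?thesis by simp
qed

section \<open>The size of the union\<close>

text \<open>
  The equation \<open>y = a x + N / x\<close> is the quadratic \<open>a x\<^sup>2 - y x + N = 0\<close>. A root of it is
  automatically nonzero, since \<open>N\<close> is.
\<close>

lemma mem_H_iff:
  fixes a N y :: "'p::prime_card mod_ring"
  assumes card: "CARD('p) > 2" and a: "a \<noteq> 0" and N: "N \<noteq> 0"
  shows "y \<in> H a N \<longleftrightarrow> chi (y^2 - 4 * a * N) \<noteq> -1"
proof
  assume "y \<in> H a N"
  then obtain x where x: "x \<noteq> 0" and y: "y = a * x + N * inverse x" by (auto simp: H_def)
  have "y^2 - 4 * a * N = (a * x - N * inverse x)^2"
    using x unfolding y by (simp add: power2_eq_square field_simps)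
  then show "chi (y^2 - 4 * a * N) \<noteq> -1" unfolding chi_neq_minus_one_iff by blast
next
  note two = two_neq_zero[OF card] and four = four_neq_zero[OF card]
  assume "chi (y^2 - 4 * a * N) \<noteq> -1"
  then obtain s where s: "y^2 - 4 * a * N = s^2" unfolding chi_neq_minus_one_iff by blast
  then have prod: "(y + s) * (y - s) = 4 * a * N"
    by (simp add: algebra_simps power2_eq_square)
  then have nz: "y + s \<noteq> 0" using four a N by auto
  define x where "x = (y + s) / (2 * a)"
  have "x \<noteq> 0" using nz two a by (simp add: x_def)
  have "N * inverse x = 2 * a * N / (y + s)" by (simp add: x_def field_simps)
  also have "2 * a * N = (y + s) * ((y - s) / 2)" using two prod by (simp add: field_simps)
  also have "(y + s) * ((y - s) / 2) / (y + s) = (y - s) / 2"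
    by (rule nonzero_mult_div_cancel_left[OF nz])
  finally have "a * x + N * inverse x = (y + s) / 2 + (y - s) / 2"
    using a by (simp add: x_def)
  also have "\<dots> = y" by (rule half_sum_plus_half_diff[OF card])
  finally show "y \<in> H a N" using \<open>x \<noteq> 0\<close> unfolding H_def by force
qed

lemma card_U:
  fixes a b N A B :: "'p::prime_card mod_ring"
  assumes card: "CARD('p) > 2" and a: "a \<noteq> 0" and b: "b \<noteq> 0" and N: "N \<noteq> 0" and ab: "a \<noteq> b"
    and A: "A = 4 * a * N" and B: "B = 4 * b * N"
  shows "4 * int (card (U a b N)) = 3 * int CARD('p) - 2 - K A B + r A + r B - E A B"
proof -
  have A0: "A \<noteq> 0" and B0: "B \<noteq> 0" and AB: "A \<noteq> B"
    using four_neq_zero[OF card] a b N ab by (auto simp: A B)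
  (* Four times the indicator of U, i.e. 4 - (1 - f) (1 - g), plus the values 1 - g at the
     zeros of f and 1 - f at the zeros of g, where the true value is 4. *)
  have indicator: "4 * of_bool (y \<in> U a b N) =
      3 + chi (y^2 - A) + chi (y^2 - B) - chi ((y^2 - A) * (y^2 - B))
        + of_bool (y^2 = A) * (1 - chi (A - B)) + of_bool (y^2 = B) * (1 - chi (B - A))" for y
  proof -
    have mem: "y \<in> U a b N \<longleftrightarrow> chi (y^2 - A) \<noteq> -1 \<or> chi (y^2 - B) \<noteq> -1"
      by (simp add: U_def mem_H_iff[OF card _ N] a b A B)
    consider "y^2 = A" | "y^2 = B" | "y^2 \<noteq> A" "y^2 \<noteq> B" by blast
    then show ?thesis
    proof cases
      case 3
      then have "chi (y^2 - A) \<in> {-1, 1}" "chi (y^2 - B) \<in> {-1, 1}"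
        by (auto simp: chi_eq)
      with 3 show ?thesis by (auto simp: mem chi_mult[OF card])
    qed (use AB in \<open>auto simp: mem\<close>)
  qed
  have roots: "(\<Sum>y\<in>UNIV. of_bool (y^2 = T) * c) = r T * c" for T :: "'p mod_ring" and c :: int
    by (simp add: card_square_roots[OF card, symmetric] sum_of_bool_eq flip: sum_distrib_right)
  have "4 * int (card (U a b N)) = (\<Sum>y\<in>UNIV. 4 * of_bool (y \<in> U a b N))"
    by (simp add: sum_of_bool_eq flip: sum_distrib_left)
  also have "\<dots> = 3 * int CARD('p) - 1 - 1 - K A B + r A * (1 - chi (A - B)) + r B * (1 - chi (B - A))"
    unfolding indicator
    by (simp add: sum.distrib sum_subtractf sum_chi_square_minus[OF card] A0 B0 K_def roots)
  finally show ?thesis by (simp add: E_def algebra_simps)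
qed

theorem corollary6p1:
  fixes \<gamma> N A B :: "'p::prime_card mod_ring"
  assumes "CARD('p) > 2"
    and "primitive_root \<gamma>"
    and "N \<noteq> 0"
    and "A = 4 * \<gamma> * N"
    and "B = 4 * \<gamma>^2 * N"
  shows "E A B \<in> {-2, 2} \<and>
    real (card (U \<gamma> (\<gamma>^2) N)) = (3 * real CARD('p) - real_of_int (K A B) - real_of_int (E A B)) / 4"
proof
  note card = assms(1)
  have chi_\<gamma>: "chi \<gamma> = -1" by (rule chi_primitive_root[OF assms(1,2)])
  have \<gamma>0: "\<gamma> \<noteq> 0" using chi_\<gamma> by auto
  have \<gamma>1: "\<gamma> \<noteq> 1" using chi_\<gamma> chi_square[of "1 :: 'p mod_ring"] by auto
  have A0: "A \<noteq> 0"
    using four_neq_zero[OF card] \<gamma>0 assms(3,4) by simp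
  have BA: "B = \<gamma> * A" by (simp add: assms(4,5) power2_eq_square algebra_simps)
  then have chi_B: "chi B = - chi A" by (simp add: chi_mult[OF card] chi_\<gamma>)
  have AB: "A \<noteq> B" using A0 \<gamma>1 BA by auto
  have "chi A \<in> {-1, 1}" "chi (B - A) \<in> {-1, 1}" "chi (A - B) \<in> {-1, 1}"
    using A0 AB by (auto simp: chi_eq)
  then show "E A B \<in> {-2, 2}" by (auto simp: E_def r_def chi_B)
  have "\<gamma> \<noteq> \<gamma>^2" using \<gamma>0 \<gamma>1 by (simp add: power2_eq_square)
  then have "4 * int (card (U \<gamma> (\<gamma>^2) N)) =
      3 * int CARD('p) - 2 - K A B + r A + r B - E A B"
    using card_U[OF card \<gamma>0 _ assms(3) _ assms(4,5)] \<gamma>0 by simp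
  also have "\<dots> = 3 * int CARD('p) - K A B - E A B" by (simp add: r_def chi_B)
  finally have "4 * real (card (U \<gamma> (\<gamma>^2) N)) =
      3 * real CARD('p) - real_of_int (K A B) - real_of_int (E A B)"
    by linarith
  then show "real (card (U \<gamma> (\<gamma>^2) N)) =
      (3 * real CARD('p) - real_of_int (K A B) - real_of_int (E A B)) / 4"
    by simp
qed

end
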